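(* If $Y\subset\mathbb{R}^p$ is closed and convex and $Y_N\neq\emptyset$, then all of the following hold: (i) $Y$ is $\mathbb{R}^p_{\geqq}$-compact; (ii) $Y$ is $\mathbb{R}^p_{\geqq}$-semicompact; (iii) $Y_N$ is externally stable; (iv) $Y_N$ is connected.
   Context: For $a,b\in\mathbb{R}^p$: $a\leqq b$ means $a_j\le b_j$ for every $j$; $a\leq b$ means $a\leqq b$ and $a\neq b$. Let $\mathbb{R}^p_{\geqq}=\{y\in\mathbb{R}^p: y_j\ge 0\ \text{for every } j\}$. For $Y\subseteq\mathbb{R}^p$, a point $y^0\in Y$ is nondominated if there is no $y\in Y$ with $y\leq y^0$; $Y_N$ denotes the set of all nondominated points of $Y$. A set $Y\subseteq\mathbb{R}^p$ is called: - $\mathbb{R}^p_{\geqq}$-compact if $(y-\mathbb{R}^p_{\geqq})\cap Y$ is compact for every $y\in Y$; - $\mathbb{R}^p_{\geqq}$-semicompact if every open cover of $Y$ of the form $\{(y^i-\mathbb{R}^p_{\geqq})^c : y^i\in Y,\ i\in\mathcal{I}\}$ has a finite subcover, where $S^c$ denotes the complement of $S$ in $\mathbb{R}^p$. The set $Y_N$ is called externally stable if $Y\subseteq Y_N+\mathbb{R}^p_{\geqq}$ (Minkowski sum). A set $S\subseteq\mathbb{R}^p$ is not connected if there exist open sets $O_1,O_2$ such that $S\subseteq O_1\cup O_2$, $S\cap O_1\neq\emptyset$, $S\cap O_2\neq\emptyset$ and $S\cap O_1\cap O_2=\emptyset$; otherwise $S$ is connected. *)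

theory Defs
  imports "HOL-Analysis.Analysis" "HOL-Library.Set_Algebras"
begin

text \<open>
  On \<^typ>\<open>real ^ 'n\<close> the library order \<open>\<le>\<close> is the componentwise order,
  i.e. the relation written $\leqq$ in multiobjective optimisation; the relation written
  $\leq$ there is \<open>y \<le> y' \<and> y \<noteq> y'\<close>.
\<close>

definition nonneg_orthant :: "(real ^ 'n) set" where
  "nonneg_orthant = {y. \<forall>j. 0 \<le> y $ j}"

definition nondominated :: "(real ^ 'n) set \<Rightarrow> (real ^ 'n) set" where
  "nondominated Y = {y0 \<in> Y. \<not> (\<exists>y\<in>Y. y \<le> y0 \<and> y \<noteq> y0)}"

text \<open>
  The Minkowski difference $y - \mathbb{R}^p_{\geqq}$; an image is used because
  \<open>-\<close> on sets is set difference.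
\<close>

definition lower_orthant :: "real ^ 'n \<Rightarrow> (real ^ 'n) set" where
  "lower_orthant y = (\<lambda>d. y - d) ` nonneg_orthant"

definition orthant_compact :: "(real ^ 'n) set \<Rightarrow> bool" where
  "orthant_compact Y \<longleftrightarrow> (\<forall>y\<in>Y. compact (lower_orthant y \<inter> Y))"

definition orthant_semicompact :: "(real ^ 'n) set \<Rightarrow> bool" where
  "orthant_semicompact Y \<longleftrightarrow>
     (\<forall>\<U>. \<U> \<subseteq> (\<lambda>y. - lower_orthant y) ` Y \<and> (\<forall>U\<in>\<U>. open U) \<and> Y \<subseteq> \<Union>\<U>
        \<longrightarrow> (\<exists>\<V>\<subseteq>\<U>. finite \<V> \<and> Y \<subseteq> \<Union>\<V>))"

text \<open>Here \<open>+\<close> is the Minkowski sum of sets.\<close>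

definition externally_stable :: "(real ^ 'n) set \<Rightarrow> bool" where
  "externally_stable Y \<longleftrightarrow> Y \<subseteq> nondominated Y + nonneg_orthant"

end

theory Submission
  imports Defs
begin

text \<open>
  If \<open>a\<close> is nondominated, then no direction of recession of \<open>Y\<close> is \<open>\<le> 0\<close> and nonzero, so
  \<open>Y \<inter> {..c}\<close> is compact for every \<open>c\<close>, even outside \<open>Y\<close>. Two nondominated points both lie
  below their componentwise maximum \<open>c\<close>, and the nondominated points of \<open>Y \<inter> {..c}\<close> are those of
  \<open>Y\<close> below \<open>c\<close>, so connectedness reduces to compact convex sets. There, the minimisers of
  positive linear functionals form a connected set of nondominated points that is dense among
  all of them.
\<close>

section \<open>Order intervals and nondominated points\<close>

lemma lower_orthant_eq_atMost: "lower_orthant y = {..y}"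
proof -
  have "x \<in> lower_orthant y" if "x \<le> y" for x
    using that unfolding lower_orthant_def nonneg_orthant_def
    by (intro image_eqI[of _ _ "y - x"]) (auto simp: less_eq_vec_def)
  then show ?thesis
    by (auto simp: lower_orthant_def nonneg_orthant_def less_eq_vec_def)
qed

lemma nondominated_iff:
  "y \<in> nondominated Y \<longleftrightarrow> y \<in> Y \<and> (\<forall>x\<in>Y. x \<le> y \<longrightarrow> x = y)"
  by (auto simp: nondominated_def)

lemma nondominated_Int_atMost: "nondominated (Y \<inter> {..c}) = nondominated Y \<inter> {..c}"
  by (auto simp: nondominated_iff intro: order_trans)

section \<open>Compact sections and their consequences\<close>

lemma compact_Int_atMost_of_nondominated:
  fixes Y :: "(real ^ 'n) set"
  assumes "closed Y" "convex Y" "nondominated Y \<noteq> {}"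
  shows "compact (Y \<inter> {..c})"
proof -
  obtain a where a: "a \<in> Y" "\<And>y. y \<in> Y \<Longrightarrow> y \<le> a \<Longrightarrow> y = a"
    using assms(3) by (metis ex_in_conv nondominated_iff)
  define g :: "real ^ 'n \<Rightarrow> real" where "g y = (\<Sum>j\<in>UNIV. max 0 (y $ j - a $ j))" for y
  \<comment> \<open>\<open>g (a + v)\<close> is positively homogeneous in \<open>v\<close>, so by convexity a positive lower bound \<open>\<delta>\<close>
    on the unit sphere around \<open>a\<close> gives \<open>g y \<ge> \<delta> * dist a y\<close> for all \<open>y\<in>Y\<close> outside it.\<close>
  have g_pos: "g y > 0" if "y \<in> Y" "y \<noteq> a" for y
  proof -
    have "\<not> y \<le> a" using a(2) that by blast
    then obtain j where "a $ j < y $ j" by (auto simp: less_eq_vec_def not_le)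
    then show ?thesis unfolding g_def by (intro sum_pos2[of _ j]) auto
  qed
  have "compact (Y \<inter> sphere a 1)"
    using assms(1) by (simp add: closed_Int_compact)
  moreover have "continuous_on (Y \<inter> sphere a 1) g"
    unfolding g_def by (intro continuous_intros)
  ultimately obtain \<delta> where \<delta>: "\<delta> > 0" "\<And>y. y \<in> Y \<inter> sphere a 1 \<Longrightarrow> \<delta> \<le> g y"
  proof (cases "Y \<inter> sphere a 1 = {}")
    case True
    \<comment> \<open>The bound is vacuous here, so any positive value serves.\<close>
    then show ?thesis using that[of 1] by auto
  next
    case False
    assume "compact (Y \<inter> sphere a 1)" "continuous_on (Y \<inter> sphere a 1) g"
    then obtain k where k: "k \<in> Y \<inter> sphere a 1" "\<And>y. y \<in> Y \<inter> sphere a 1 \<Longrightarrow> g k \<le> g y"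
      using continuous_attains_inf[OF _ False] by metis
    moreover have "g k > 0" using k by (intro g_pos) auto
    ultimately show ?thesis using that by blast
  qed
  have "dist a x \<le> max 1 (g c / \<delta>)" if x: "x \<in> Y" "x \<le> c" for x
  proof (cases "dist a x \<le> 1")
    case False
    define s where "s = inverse (dist a x)"
    have s: "0 < s" "s \<le> 1" "s * dist a x = 1"
      using False by (auto simp: s_def inverse_le_1_iff intro!: left_inverse)
    have "(1 - s) *\<^sub>R a + s *\<^sub>R x \<in> Y"
      using assms(2) a(1) x(1) s by (intro convexD_alt) auto
    moreover have eq: "(1 - s) *\<^sub>R a + s *\<^sub>R x = a + s *\<^sub>R (x - a)"
      by (simp add: algebra_simps)
    moreover have "dist a (a + s *\<^sub>R (x - a)) = 1"
      using s by (simp add: dist_norm norm_minus_commute)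
    ultimately have "\<delta> \<le> g (a + s *\<^sub>R (x - a))"
      by (intro \<delta>(2)) auto
    also have "\<dots> = s * g x"
      using s unfolding g_def sum_distrib_left
      by (intro sum.cong) (auto simp: max_def mult_le_0_iff zero_le_mult_iff)
    finally have "\<delta> * dist a x \<le> s * dist a x * g x"
      by (metis mult.assoc mult.commute mult_right_mono zero_le_dist)
    \<comment> \<open>The factor \<open>s * dist a x\<close> is 1, and \<open>g\<close> is monotone
      in the componentwise order.\<close>
    also have "\<dots> \<le> g c"
      using x(2) s unfolding g_def
      by (auto intro!: sum_mono max.mono diff_right_mono simp: less_eq_vec_def simp del: max.bounded_iff)
    finally show ?thesis
      using \<delta>(1) by (simp add: field_simps le_max_iff_disj)
  qed auto
  then have "bounded (Y \<inter> {..c})"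
    unfolding bounded_def by (intro exI[of _ a]) auto
  then show ?thesis
    using assms(1) by (simp add: compact_eq_bounded_closed closed_Int closed_eucl_atMost)
qed

text \<open>Take a minimiser of the coordinate sum over the section: a point of \<open>Y\<close>
  dominating it would lie in the section too and have a smaller sum.\<close>

lemma nondominated_le_exists:
  fixes Y :: "(real ^ 'n) set"
  assumes "compact (Y \<inter> {..c})" "Y \<inter> {..c} \<noteq> {}"
  obtains y where "y \<in> nondominated Y" "y \<le> c"
proof -
  have "continuous_on (Y \<inter> {..c}) (\<lambda>y. \<Sum>j\<in>UNIV. y $ j)"
    by (intro continuous_intros)
  then obtain y where y: "y \<in> Y \<inter> {..c}"
    and min: "\<And>x. x \<in> Y \<inter> {..c} \<Longrightarrow> (\<Sum>j\<in>UNIV. y $ j) \<le> (\<Sum>j\<in>UNIV. x $ j)"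
    using continuous_attains_inf[OF assms] by metis
  have "x = y" if x: "x \<in> Y" "x \<le> y" for x
  proof (rule ccontr)
    assume "x \<noteq> y"
    then obtain j where "x $ j \<noteq> y $ j" by (auto simp: vec_eq_iff)
    then have "(\<Sum>j\<in>UNIV. x $ j) < (\<Sum>j\<in>UNIV. y $ j)"
      using x(2) by (intro sum_strict_mono_ex1) (auto simp: less_eq_vec_def order_less_le)
    moreover have "x \<in> Y \<inter> {..c}" using x y by auto
    ultimately show False using min by fastforce
  qed
  then show ?thesis using that y by (auto simp: nondominated_iff)
qed

text \<open>A single member of the cover leaves only a compact part of \<open>Y\<close> uncovered,
  and finitely many further members cover that.\<close>

lemma orthant_semicompact_if_orthant_compact:
  assumes "orthant_compact Y"
  shows "orthant_semicompact Y"
  unfolding orthant_semicompact_def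
proof (intro allI impI, elim conjE)
  fix \<U> assume U: "\<U> \<subseteq> (\<lambda>y. - lower_orthant y) ` Y" "\<forall>U\<in>\<U>. open U" "Y \<subseteq> \<Union>\<U>"
  show "\<exists>\<V>\<subseteq>\<U>. finite \<V> \<and> Y \<subseteq> \<Union>\<V>"
  proof (cases "\<U> = {}")
    case True
    then show ?thesis using U(3) by auto
  next
    case False
    then obtain y where y: "y \<in> Y" "- lower_orthant y \<in> \<U>" using U(1) by blast
    have "compact (lower_orthant y \<inter> Y)"
      using assms y(1) by (simp add: orthant_compact_def)
    then obtain \<V> where "\<V> \<subseteq> \<U>" "finite \<V>" "lower_orthant y \<inter> Y \<subseteq> \<Union>\<V>"
      using U by (elim compactE[of _ \<U>]) auto
    then show ?thesis
      using y(2) by (intro exI[of _ "insert (- lower_orthant y) \<V>"]) auto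
  qed
qed

section \<open>Weighted-sum minimisers and compact convex sets\<close>

definition supported :: "(real ^ 'n) set \<Rightarrow> (real ^ 'n) set" where
  "supported Y = {y \<in> Y. \<exists>l. (\<forall>j. 0 < l $ j) \<and> (\<forall>x\<in>Y. l \<bullet> y \<le> l \<bullet> x)}"

text \<open>As every weight is strictly positive, a dominating point would have a strictly smaller
  weighted sum.\<close>

lemma supported_subset_nondominated: "supported Y \<subseteq> nondominated Y"
proof
  fix y assume "y \<in> supported Y"
  then obtain l where y: "y \<in> Y" and l: "\<And>j. 0 < l $ j" "\<And>x. x \<in> Y \<Longrightarrow> l \<bullet> y \<le> l \<bullet> x"
    by (auto simp: supported_def)
  have "x = y" if x: "x \<in> Y" "x \<le> y" for x
  proof (rule ccontr)
    assume "x \<noteq> y"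
    then obtain j where "x $ j \<noteq> y $ j" by (auto simp: vec_eq_iff)
    then have "l \<bullet> x < l \<bullet> y"
      unfolding inner_vec_def using x(2) l(1)
      by (intro sum_strict_mono_ex1)
        (auto simp: less_eq_vec_def order_less_le intro!: mult_left_mono bexI[of _ j])
    then show False using l(2)[OF x(1)] by simp
  qed
  then show "y \<in> nondominated Y" using y by (simp add: nondominated_iff)
qed

text \<open>
  The projection \<open>y\<close> of \<open>z\<close> onto \<open>Y\<close> minimises the inner product with \<open>y - z\<close>. If \<open>z\<close> lies
  strictly below \<open>Y\<close> this weight is positive, and every positive weight \<open>l\<close> arises from a point
  \<open>y - t *\<^sub>R l\<close> with \<open>t\<close> large.
\<close>

lemma connected_supported:
  fixes Y :: "(real ^ 'n) set"
  assumes "compact Y" "convex Y"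
  shows "connected (supported Y)"
proof (cases "Y = {}")
  case True
  then show ?thesis by (simp add: supported_def)
next
  case False
  have cl: "closed Y" using assms(1) by (rule compact_imp_closed)
  obtain B where B: "\<And>y. y \<in> Y \<Longrightarrow> norm y \<le> B"
    using compact_imp_bounded[OF assms(1)] by (auto simp: bounded_iff)
  have lower: "- B \<le> y $ j" and upper: "y $ j \<le> B" if "y \<in> Y" for y j
    using component_le_norm_cart[of y j] B[OF that] by auto
  define Z :: "(real ^ 'n) set" where "Z = {z. \<forall>j. z $ j < - B}"
  have "supported Y = closest_point Y ` Z"
  proof (intro equalityI subsetI)
    fix y assume "y \<in> closest_point Y ` Z"
    then obtain z where z: "z \<in> Z" "y = closest_point Y z" by auto
    have y: "y \<in> Y" using closest_point_in_set[OF cl False] z(2) by simp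
    have "(y - z) \<bullet> y \<le> (y - z) \<bullet> x" if "x \<in> Y" for x
      using closest_point_dot[OF assms(2) cl that, of z] z(2)
      by (simp add: inner_diff_left inner_diff_right)
    moreover have "0 < (y - z) $ j" for j
      using lower[OF y, of j] z(1) by (auto simp: Z_def dest: spec[of _ j])
    ultimately show "y \<in> supported Y" using y unfolding supported_def by blast
  next
    fix y assume "y \<in> supported Y"
    then obtain l where y: "y \<in> Y" and l: "\<And>j. 0 < l $ j" "\<And>x. x \<in> Y \<Longrightarrow> l \<bullet> y \<le> l \<bullet> x"
      by (auto simp: supported_def)
    have "0 \<le> B" using B[OF y] norm_ge_zero order_trans by blast
    \<comment> \<open>The sum bounds each of its summands, so every coordinate drops by at least
      \<open>2 * B + 1\<close>: from at most \<open>B\<close> to strictly below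
      \<open>- B\<close>.\<close>
    define t where "t = (\<Sum>j\<in>UNIV. (2 * B + 1) / l $ j)"
    have "(2 * B + 1) / l $ j \<le> t" for j
      unfolding t_def using l(1) \<open>0 \<le> B\<close>
      by (intro member_le_sum) (auto simp: less_imp_le)
    then have t: "2 * B + 1 \<le> t * l $ j" for j
      by (simp add: pos_divide_le_eq[OF l(1)])
    have "0 \<le> t"
      unfolding t_def using l(1) \<open>0 \<le> B\<close> by (intro sum_nonneg) (auto simp: less_imp_le)
    have "y - t *\<^sub>R l \<in> Z"
    proof -
      have "y $ j - t * l $ j < - B" for j using t[of j] upper[OF y, of j] by linarith
      then show ?thesis by (simp add: Z_def)
    qed
    moreover have "y = closest_point Y (y - t *\<^sub>R l)"
    proof (rule closest_point_unique[OF assms(2) cl y], intro ballI)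
      fix x assume x: "x \<in> Y"
      have "0 \<le> t * (l \<bullet> (x - y))"
        using l(2)[OF x] \<open>0 \<le> t\<close> by (simp add: inner_diff_right)
      \<comment> \<open>Adding a vector at a non-obtuse angle cannot shorten
        \<open>t *\<^sub>R l\<close>.\<close>
      then have "norm (t *\<^sub>R l) \<le> norm (t *\<^sub>R l + (x - y))"
        unfolding norm_le inner_add_left inner_add_right inner_commute[of "x - y" "t *\<^sub>R l"]
        by simp
      then show "dist (y - t *\<^sub>R l) y \<le> dist (y - t *\<^sub>R l) x"
        unfolding dist_norm norm_minus_commute[of "y - t *\<^sub>R l" x]
        by (simp add: algebra_simps)
    qed
    ultimately show "y \<in> closest_point Y ` Z" by blast
  qed
  moreover have "convex Z"
    unfolding Z_def convex_def by (auto intro: convex_bound_lt)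
  ultimately show ?thesis
    by (metis connected_continuous_image continuous_on_closest_point[OF assms(2) cl False]
        convex_connected)
qed

text \<open>First-order optimality: the gradient at \<open>y\<close> is \<open>t\<close> times a
  vector with positive entries, and that vector serves as the weight.\<close>

lemma exp_sum_minimizer_supported:
  fixes Y :: "(real ^ 'n) set"
  assumes "convex Y" "y \<in> Y" "t > 0"
    and min: "\<And>x. x \<in> Y \<Longrightarrow>
      (\<Sum>j\<in>UNIV. exp (t * (y $ j - a $ j))) \<le> (\<Sum>j\<in>UNIV. exp (t * (x $ j - a $ j)))"
  shows "y \<in> supported Y"
proof -
  define l :: "real ^ 'n" where "l = (\<chi> j. exp (t * (y $ j - a $ j)))"
  have "l \<bullet> y \<le> l \<bullet> x" if x: "x \<in> Y" for x
  proof (rule ccontr)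
    assume less: "\<not> l \<bullet> y \<le> l \<bullet> x"
    define f where "f s = (\<Sum>j\<in>UNIV. exp (t * ((y + s *\<^sub>R (x - y)) $ j - a $ j)))" for s
    have "(f has_real_derivative t * (l \<bullet> (x - y))) (at 0)"
      unfolding f_def
      by (auto intro!: derivative_eq_intros sum.cong
          simp: l_def inner_vec_def sum_distrib_left sum_distrib_right mult_ac)
    moreover have "t * (l \<bullet> (x - y)) < 0"
      using less assms(3) by (simp add: inner_diff_right mult_pos_neg)
    ultimately obtain d where d: "d > 0" "\<And>h. 0 < h \<Longrightarrow> h < d \<Longrightarrow> f (0 + h) < f 0"
      by (metis DERIV_neg_dec_right)
    \<comment> \<open>Small enough for \<open>f\<close> to decrease, and at most 1 to stay on the
      segment from \<open>y\<close> to \<open>x\<close>.\<close>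
    define h where "h = min 1 (d / 2)"
    have h: "0 < h" "h < d" "h \<le> 1" using d(1) by (auto simp: h_def)
    have "(1 - h) *\<^sub>R y + h *\<^sub>R x \<in> Y"
      using assms(1,2) x h by (intro convexD_alt) auto
    then have "y + h *\<^sub>R (x - y) \<in> Y" by (simp add: algebra_simps)
    from min[OF this] have "f 0 \<le> f h" by (simp add: f_def)
    then show False using d(2)[OF h(1,2)] by simp
  qed
  moreover have "0 < l $ j" for j by (simp add: l_def)
  ultimately show ?thesis using assms(2) unfolding supported_def by blast
qed

text \<open>
  For \<open>a\<close> nondominated, a minimiser \<open>y\<close> of \<open>\<Sum>j. exp (t * (y $ j - a $ j))\<close> satisfies
  \<open>y $ j \<le> a $ j + ln p / t\<close>, as the value at \<open>a\<close> is \<open>p\<close>. Limit points of such minimisers for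
  \<open>t \<rightarrow> \<infinity>\<close> are therefore below \<open>a\<close>, hence equal to \<open>a\<close>.
\<close>

lemma nondominated_subset_closure_supported:
  fixes Y :: "(real ^ 'n) set"
  assumes "compact Y" "convex Y"
  shows "nondominated Y \<subseteq> closure (supported Y)"
proof
  fix a assume "a \<in> nondominated Y"
  then have a: "a \<in> Y" "\<And>x. x \<in> Y \<Longrightarrow> x \<le> a \<Longrightarrow> x = a" by (auto simp: nondominated_iff)
  define p where "p = real CARD('n)"
  have "p \<ge> 1" by (simp add: p_def Suc_le_eq)
  \<comment> \<open>\<open>Suc n\<close> keeps the exponential parameter positive at
    \<open>n = 0\<close>.\<close>
  have "\<exists>y\<in>supported Y. \<forall>j. y $ j \<le> a $ j + ln p / real (Suc n)" for n
  proof -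
    let ?f = "\<lambda>y. \<Sum>j\<in>UNIV. exp (real (Suc n) * (y $ j - a $ j))"
    have "continuous_on Y ?f" by (intro continuous_intros)
    then obtain y where y: "y \<in> Y" "\<And>x. x \<in> Y \<Longrightarrow> ?f y \<le> ?f x"
      using continuous_attains_inf[OF assms(1), of ?f] a(1) by blast
    have "y \<in> supported Y"
      using y by (intro exp_sum_minimizer_supported[OF assms(2), of _ "real (Suc n)" a]) auto
    moreover have "y $ j \<le> a $ j + ln p / real (Suc n)" for j
    proof -
      have "exp (real (Suc n) * (y $ j - a $ j)) \<le> ?f y"
        by (intro member_le_sum) auto
      also have "\<dots> \<le> p" using y(2)[OF a(1)] by (simp add: p_def)
      finally have "real (Suc n) * (y $ j - a $ j) \<le> ln p"
        using \<open>p \<ge> 1\<close> by (simp add: ln_ge_iff)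
      then show ?thesis by (simp add: field_simps)
    qed
    ultimately show ?thesis by blast
  qed
  then obtain y where y: "\<And>n. y n \<in> supported Y"
    and le: "\<And>n j. y n $ j \<le> a $ j + ln p / real (Suc n)"
    by metis
  have "y n \<in> Y" for n using y[of n] by (simp add: supported_def)
  then obtain b r where b: "b \<in> Y" "strict_mono r" "(y \<circ> r) \<longlonglongrightarrow> b"
    using assms(1) unfolding compact_def by metis
  have "b $ j \<le> a $ j" for j
  proof (rule LIMSEQ_le)
    show "(\<lambda>n. (y \<circ> r) n $ j) \<longlonglongrightarrow> b $ j" using b(3) by (rule tendsto_vec_nth)
    have "(\<lambda>n. a $ j + ln p * inverse (real (Suc n))) \<longlonglongrightarrow> a $ j + ln p * 0"
      by (intro tendsto_intros LIMSEQ_inverse_real_of_nat)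
    from LIMSEQ_subseq_LIMSEQ[OF this b(2)]
    show "(\<lambda>n. a $ j + ln p / real (Suc (r n))) \<longlonglongrightarrow> a $ j"
      by (simp add: o_def divide_inverse)
    show "\<exists>N. \<forall>n\<ge>N. (y \<circ> r) n $ j \<le> a $ j + ln p / real (Suc (r n))"
      using le by auto
  qed
  then have "b = a" using a(2) b(1) by (simp add: less_eq_vec_def)
  then show "a \<in> closure (supported Y)"
    using b(3) y unfolding closure_sequential by (intro exI[of _ "y \<circ> r"]) auto
qed

text \<open>A set between a connected set and its closure is connected.\<close>

lemma connected_nondominated_if_compact:
  fixes Y :: "(real ^ 'n) set"
  assumes "compact Y" "convex Y"
  shows "connected (nondominated Y)"
  using connected_intermediate_closure[OF connected_supported[OF assms]
      supported_subset_nondominated nondominated_subset_closure_supported[OF assms]] .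

section \<open>Closed convex sets, by reduction to compact sections\<close>

theorem corollary4p1:
  fixes Y :: "(real ^ 'n) set"
  assumes "closed Y" and "convex Y" and "nondominated Y \<noteq> {}"
  shows "orthant_compact Y \<and> orthant_semicompact Y \<and> externally_stable Y \<and> connected (nondominated Y)"
proof (intro conjI)
  note cpt = compact_Int_atMost_of_nondominated[OF assms]
  show oc: "orthant_compact Y"
    using cpt by (simp add: orthant_compact_def lower_orthant_eq_atMost Int_commute)
  then show "orthant_semicompact Y" by (rule orthant_semicompact_if_orthant_compact)
  show "externally_stable Y"
    unfolding externally_stable_def
  proof
    fix y assume "y \<in> Y"
    then have "Y \<inter> {..y} \<noteq> {}" by auto
    then obtain x where x: "x \<in> nondominated Y" "x \<le> y"
      using nondominated_le_exists[OF cpt] by metis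
    then have "y - x \<in> nonneg_orthant" by (simp add: nonneg_orthant_def less_eq_vec_def)
    then show "y \<in> nondominated Y + nonneg_orthant"
      using set_plus_intro[OF x(1)] by force
  qed
  show "connected (nondominated Y)"
  proof (subst connected_iff_connected_component, intro ballI)
    fix a b assume ab: "a \<in> nondominated Y" "b \<in> nondominated Y"
    define c :: "real ^ 'n" where "c = (\<chi> j. max (a $ j) (b $ j))"
    have "convex {..c}"
      by (auto simp: convex_def less_eq_vec_def intro: convex_bound_le)
    then have "connected (nondominated (Y \<inter> {..c}))"
      by (intro connected_nondominated_if_compact cpt convex_Int assms(2))
    moreover have "a \<le> c" "b \<le> c" by (auto simp: c_def less_eq_vec_def)
    ultimately show "connected_component (nondominated Y) a b"
      unfolding connected_component_def nondominated_Int_atMost using ab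
      by (intro exI[of _ "nondominated Y \<inter> {..c}"]) auto
  qed
qed

end
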